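(* Let $k\geq 1$, let $K\subseteq \mathbb{R}^k$, and let $\epsilon\geq 0$ and $\delta>0$ satisfy $2\delta+\epsilon<1$. Let \begin{align*} G=\{(x,r)\in\mathbb{R}^k\times\mathbb{R}^+ :\ & 0<r<d(x,K),\text{ and there exist }z_1,z_2\in K \text{ such that } d(x,z_1)\leq d(x,K)+\epsilon r,\\ & d(x,z_2)\leq d(x,K)+\epsilon r, \text{ but } |\theta|>\cos^{-1}\left(2\left(\frac{1-(2\delta +\epsilon)}{1+2\delta}\right)^2-1\right)\}, \end{align*} where $\theta$ is the angle between the segments $[x,z_1]$ and $[x,z_2]$. Then $G$ is a Carleson set, and its Carleson constant is bounded above by a constant depending only on $\delta$ and $k$.
   Context: $d(p,q)=|p-q|$ is the Euclidean distance on $\mathbb{R}^k$, and $d(p,K)=\inf\{d(p,x):x\in K\}$. $\mathbb{R}^+$ denotes the positive reals. For a measurable $D\subseteq \mathbb{R}^k\times\mathbb{R}^+$ write $D_r=\{x:(x,r)\in D\}$. $D$ is a Carleson set if there is $C\geq 0$ such that for every $L>0$ and every ball $B\subseteq\mathbb{R}^k$ of radius $L$, $\int_0^L |D_r\cap B|\,\frac{dr}{r}\leq C|B|$, where $|\cdot|$ is Lebesgue measure on $\mathbb{R}^k$; the minimal such $C$ is the Carleson constant of $D$. *)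

theory Defs
  imports "HOL-Analysis.Analysis"
begin

definition seg_angle :: "'a::euclidean_space \<Rightarrow> 'a \<Rightarrow> 'a \<Rightarrow> real" where
  "seg_angle x z1 z2 = arccos (((z1 - x) \<bullet> (z2 - x)) / (norm (z1 - x) * norm (z2 - x)))"

definition slice :: "('a \<times> real) set \<Rightarrow> real \<Rightarrow> 'a set" where
  "slice D r = {x. (x, r) \<in> D}"

definition carleson_ineq :: "('a::euclidean_space \<times> real) set \<Rightarrow> real \<Rightarrow> bool" where
  "carleson_ineq D C \<longleftrightarrow>
     (\<forall>L>0. \<forall>c::'a.
        (\<integral>\<^sup>+ r. indicator {0<..<L} r * ennreal (1 / r) * emeasure lebesgue (slice D r \<inter> ball c L) \<partial>lborel)
          \<le> ennreal C * emeasure lebesgue (ball c L))"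

definition carleson_set :: "('a::euclidean_space \<times> real) set \<Rightarrow> bool" where
  "carleson_set D \<longleftrightarrow> D \<subseteq> UNIV \<times> {0<..} \<and> D \<in> sets lebesgue \<and> (\<exists>C\<ge>0. carleson_ineq D C)"

definition Gset :: "'a::euclidean_space set \<Rightarrow> real \<Rightarrow> real \<Rightarrow> ('a \<times> real) set" where
  "Gset K \<epsilon> \<delta> = {(x, r). 0 < r \<and> r < infdist x K \<and>
      (\<exists>z1\<in>K. \<exists>z2\<in>K. dist x z1 \<le> infdist x K + \<epsilon> * r \<and> dist x z2 \<le> infdist x K + \<epsilon> * r \<and>
         \<bar>seg_angle x z1 z2\<bar> > arccos (2 * ((1 - (2 * \<delta> + \<epsilon>)) / (1 + 2 * \<delta>))^2 - 1))}"

end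

theory Submission
  imports Defs
begin

text \<open>Write \<open>f = d(\<cdot>, K)\<close> and \<open>F\<^sub>h(x) = 2 f(x) - f(x + h) - f(x - h)\<close>. The distance function is
  semiconcave: \<open>F\<^sub>h(x) \<ge> -|h|\<^sup>2 / f(x)\<close>. If \<open>(x, r) \<in> G\<close>, the two almost nearest points, seen from
  \<open>x\<close> in well separated directions, force \<open>F\<^sub>h(x) \<ge> r - |h|\<^sup>2 / f(x)\<close> for some \<open>h = s r b\<close>, where \<open>b\<close>
  is a basis vector and \<open>s\<close> depends only on \<open>\<delta>\<close> and the dimension \<open>k\<close>. As \<open>f\<close> is 1-Lipschitz, the integral of
  \<open>F\<^sub>h\<close> over a ball \<open>B\<close> of radius \<open>R\<close> telescopes to \<open>O(|h|\<^sup>2 |B| / R)\<close>. Hence, by Markov's inequality,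
  \<open>|G\<^sub>r \<inter> B| = O(r |B| / R)\<close> whenever \<open>f \<ge> R\<close> on \<open>B\<close>, and this is integrable against \<open>dr / r\<close> over
  \<open>0 < r < 3 R\<close>. A Vitali covering by balls of radius comparable to the minimum of \<open>f(x)\<close> and \<open>L\<close> sums up
  these local estimates.\<close>

section \<open>Semiconcavity of the distance function\<close>

lemma infdist_attained_closure:
  fixes K :: "'a::heine_borel set"
  assumes "K \<noteq> {}"
  obtains z where "z \<in> closure K" "infdist x K = dist x z"
proof -
  obtain z where z: "z \<in> closure K" "infdist x (closure K) = dist x z"
    using infdist_attains_inf[of "closure K" x] assms by auto
  moreover have "infdist x (closure K) = infdist x K"
    using assms by (simp add: infdist_eq_setdist)
  ultimately show thesis using that by simp
qed

text \<open>As \<open>z\<close> has distance 0 from \<open>K\<close>,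
  \<open>n = norm (x + h - z)\<close> bounds the left side. The bound n \<le> (a^2 + n^2) / (2 a)
  with \<open>a = dist x z\<close> removes the square root, and expanding n^2 gives the slope and
  the quadratic error.\<close>

lemma infdist_add_le:
  fixes x h z :: "'a::real_inner"
  assumes "z \<in> closure K" "x \<noteq> z"
  shows "infdist (x + h) K \<le> dist x z - h \<bullet> (z - x) / dist x z + (norm h)\<^sup>2 / (2 * dist x z)"
proof -
  define a where "a = dist x z"
  have a: "a > 0" using assms by (simp add: a_def)
  define n where "n = norm (x + h - z)"
  have "K \<noteq> {}" using assms by auto
  have "infdist (x + h) K \<le> infdist z K + dist (x+h) z" by (rule infdist_triangle)
  also have "infdist z K = 0" using assms \<open>K \<noteq> {}\<close> by (simp add: in_closure_iff_infdist_zero)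
  finally have 1: "infdist (x + h) K \<le> n" by (simp add: n_def dist_norm)
  have n2: "n\<^sup>2 = a\<^sup>2 - 2 * (h \<bullet> (z - x)) + (norm h)\<^sup>2"
    unfolding n_def a_def dist_norm power2_norm_eq_inner
    by (simp add: inner_simps inner_commute)
  have "2 * a * n \<le> a\<^sup>2 + n\<^sup>2"
    using sum_squares_bound[of a n] by (simp add: power2_eq_square)
  then have "n \<le> (a\<^sup>2 + n\<^sup>2) / (2 * a)" using a by (simp add: field_simps)
  also have "\<dots> = a - h \<bullet> (z - x) / a + (norm h)\<^sup>2 / (2 * a)"
    using a unfolding n2 by (simp add: field_simps power2_eq_square)
  finally show ?thesis using 1 by (simp add: a_def)
qed

text \<open>With one nearest point for both \<open>h\<close> and \<open>-h\<close>, the linear terms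
  of \<open>infdist_add_le\<close> cancel.\<close>

lemma infdist_second_difference_le:
  fixes x h :: "'a::euclidean_space"
  assumes "0 < infdist x K"
  shows "infdist (x + h) K + infdist (x - h) K \<le> 2 * infdist x K + (norm h)\<^sup>2 / infdist x K"
proof -
  have "K \<noteq> {}" using assms by (auto simp: infdist_def)
  then obtain z where z: "z \<in> closure K" "infdist x K = dist x z"
    by (rule infdist_attained_closure)
  then have "x \<noteq> z" using assms by auto
  from infdist_add_le[OF z(1) this, of h] infdist_add_le[OF z(1) this, of "-h"]
  show ?thesis by (simp add: z(2))
qed

text \<open>The two almost nearest points give two upper bounds for the distance function near \<open>x\<close>,
  whose slopes in direction \<open>h\<close> differ; each side of \<open>x\<close> is bounded using the smaller slope.\<close>

lemma infdist_second_difference_le_two_points: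
  fixes x h :: "'a::euclidean_space"
  assumes "0 < infdist x K" "z1 \<in> K" "z2 \<in> K"
    and "dist x z1 \<le> infdist x K + e" "dist x z2 \<le> infdist x K + e"
  shows "infdist (x + h) K + infdist (x - h) K + \<bar>h \<bullet> (sgn (z1 - x) - sgn (z2 - x))\<bar>
    \<le> 2 * infdist x K + 2 * e + (norm h)\<^sup>2 / infdist x K"
proof -
  have *: "infdist (x + g) K \<le> infdist x K + e - g \<bullet> sgn (z - x) + (norm h)\<^sup>2 / (2 * infdist x K)"
    if "z \<in> K" "dist x z \<le> infdist x K + e" "norm g = norm h" for z g
  proof -
    have z: "infdist x K \<le> dist x z" using that by (simp add: infdist_le)
    then have "x \<noteq> z" using assms by auto
    moreover have "z \<in> closure K" using that closure_subset by auto
    ultimately have "infdist (x + g) K \<le> dist x z - g \<bullet> (z - x) / dist x z + (norm g)\<^sup>2 / (2 * dist x z)"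
      by (intro infdist_add_le)
    also have "g \<bullet> (z - x) / dist x z = g \<bullet> sgn (z - x)"
      by (simp add: sgn_div_norm dist_norm norm_minus_commute divide_inverse_commute)
    also have "(norm g)\<^sup>2 / (2 * dist x z) \<le> (norm h)\<^sup>2 / (2 * infdist x K)"
      using z assms that by (intro frac_le) auto
    finally show ?thesis using that by simp
  qed
  have "2 * ((norm h)\<^sup>2 / (2 * infdist x K)) = (norm h)\<^sup>2 / infdist x K" by simp
  then show ?thesis
    using *[OF assms(2,4), of h] *[OF assms(3,5), of "-h"]
      *[OF assms(2,4), of "-h"] *[OF assms(3,5), of h]
    by (simp add: inner_diff_right abs_if)
qed

section \<open>The angle condition and large second differences\<close>

text \<open>As \<open>arccos\<close> is nonnegative and decreasing, the angle can be eliminated.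
  What remains is a strict inequality between continuous functions of \<open>x\<close>, which serves
  both the estimates and measurability.\<close>

lemma seg_angle_gt_iff:
  assumes "-1 \<le> c" "c \<le> 1" "x \<noteq> z1" "x \<noteq> z2"
  shows "\<bar>seg_angle x z1 z2\<bar> > arccos c \<longleftrightarrow> (z1 - x) \<bullet> (z2 - x) < c * (norm (z1 - x) * norm (z2 - x))"
proof -
  let ?n = "norm (z1 - x) * norm (z2 - x)"
  have n: "?n > 0" using assms by simp
  have "\<bar>(z1 - x) \<bullet> (z2 - x)\<bar> \<le> ?n" by (rule Cauchy_Schwarz_ineq2)
  then have q: "-1 \<le> (z1 - x) \<bullet> (z2 - x) / ?n" "(z1 - x) \<bullet> (z2 - x) / ?n \<le> 1"
    using n by (auto simp: field_simps abs_le_iff)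
  have "\<bar>seg_angle x z1 z2\<bar> = seg_angle x z1 z2"
    unfolding seg_angle_def using arccos_lbound[OF q] by simp
  then have "\<bar>seg_angle x z1 z2\<bar> > arccos c \<longleftrightarrow> (z1 - x) \<bullet> (z2 - x) / ?n < c"
    unfolding seg_angle_def using arccos_less_mono[of c "(z1 - x) \<bullet> (z2 - x) / ?n"] q assms by (simp only: abs_le_iff) auto
  also have "\<dots> \<longleftrightarrow> (z1 - x) \<bullet> (z2 - x) < c * ?n"
    using n by (simp add: pos_divide_less_eq)
  finally show ?thesis .
qed

text \<open>By the double angle formula this is the cosine of twice the angle whose cosine is the
  squared quotient.\<close>

definition cos_bound :: "real \<Rightarrow> real \<Rightarrow> real" where
  "cos_bound \<epsilon> \<delta> = 2 * ((1 - (2 * \<delta> + \<epsilon>)) / (1 + 2 * \<delta>))\<^sup>2 - 1"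

text \<open>The numerator lies between 0 and 1. The second bound is free of \<epsilon>, which is how
  the final constant becomes independent of \<epsilon>.\<close>

lemma cos_bound_le:
  assumes "\<delta> > 0" "\<epsilon> \<ge> 0" "2 * \<delta> + \<epsilon> < 1"
  shows "-1 \<le> cos_bound \<epsilon> \<delta>" "cos_bound \<epsilon> \<delta> \<le> 2 / (1 + 2 * \<delta>)\<^sup>2 - 1" "cos_bound \<epsilon> \<delta> \<le> 1"
proof -
  show "-1 \<le> cos_bound \<epsilon> \<delta>" by (simp add: cos_bound_def)
  have "(1 - (2 * \<delta> + \<epsilon>))\<^sup>2 \<le> 1" using assms by (simp add: power_le_one)
  then show *: "cos_bound \<epsilon> \<delta> \<le> 2 / (1 + 2 * \<delta>)\<^sup>2 - 1"
    by (simp add: cos_bound_def power_divide divide_right_mono)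
  have "1 \<le> (1 + 2 * \<delta>)\<^sup>2" using assms by simp
  then have "2 / (1 + 2 * \<delta>)\<^sup>2 \<le> 2" using assms by (simp add: field_simps)
  with * show "cos_bound \<epsilon> \<delta> \<le> 1" by simp
qed

lemma mem_Gset_iff:
  assumes "\<delta> > 0" "\<epsilon> \<ge> 0" "2 * \<delta> + \<epsilon> < 1"
  shows "(x, r) \<in> Gset K \<epsilon> \<delta> \<longleftrightarrow> 0 < r \<and> r < infdist x K \<and>
      (\<exists>z1\<in>K. \<exists>z2\<in>K. dist x z1 \<le> infdist x K + \<epsilon> * r \<and> dist x z2 \<le> infdist x K + \<epsilon> * r \<and>
         (z1 - x) \<bullet> (z2 - x) < cos_bound \<epsilon> \<delta> * (norm (z1 - x) * norm (z2 - x)))"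
proof -
  have "x \<noteq> z" if "z \<in> K" "0 < infdist x K" for z using that by auto
  then show ?thesis
    unfolding Gset_def using seg_angle_gt_iff[of "cos_bound \<epsilon> \<delta>" x] cos_bound_le[OF assms]
    by (auto simp flip: cos_bound_def) metis+
qed

text \<open>Normalised so that the slope gap over a step of length \<open>s * r\<close> along a
  suitable basis vector is at least 3 r; the two errors \<open>\<epsilon> * r\<close> use up at most
  2 r of it. The root combines the loss sqrt k of projecting to a coordinate with the least
  separation 2 sqrt (1 - 1 / (1 + 2 \<delta>)^2) of the unit directions.\<close>

definition step_factor :: "'a::euclidean_space itself \<Rightarrow> real \<Rightarrow> real" where
  "step_factor _ \<delta> = 3 / 2 * sqrt (DIM('a) / (1 - 1 / (1 + 2 * \<delta>)\<^sup>2))"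

text \<open>Otherwise the squared coordinates would add up to less than the squared norm. This
  reduces the possible directions of the step to finitely many, the same for all points.\<close>

lemma exists_Basis_norm_le:
  fixes w :: "'a::euclidean_space"
  shows "\<exists>b\<in>Basis. norm w \<le> sqrt (DIM('a)) * \<bar>w \<bullet> b\<bar>"
proof (rule ccontr)
  assume "\<not> ?thesis"
  then have *: "sqrt DIM('a) * \<bar>w \<bullet> b\<bar> < norm w" if "b \<in> Basis" for b using that by force
  have "DIM('a) * (w \<bullet> b)\<^sup>2 < (norm w)\<^sup>2" if "b \<in> Basis" for b
    using power_strict_mono[OF *[OF that], of 2] by (simp add: power_mult_distrib)
  then have "(\<Sum>b\<in>(Basis::'a set). DIM('a) * (w \<bullet> b)\<^sup>2) < (\<Sum>b\<in>(Basis::'a set). (norm w)\<^sup>2)"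
    by (intro sum_strict_mono) auto
  also have "\<dots> = DIM('a) * (norm w)\<^sup>2" by simp
  also have "(\<Sum>b\<in>(Basis::'a set). DIM('a) * (w \<bullet> b)\<^sup>2) = DIM('a) * (norm w)\<^sup>2"
    unfolding sum_distrib_left[symmetric] power2_norm_eq_inner
    by (subst (2) euclidean_inner) (simp add: power2_eq_square)
  finally show False by simp
qed

text \<open>Unit vectors u, v satisfy |u - v|^2 = 2 - 2 (u . v), so the angle condition bounds the
  difference \<open>w\<close> of the two unit directions from below, and some coordinate of
  \<open>w\<close> is large.\<close>

lemma Gset_second_difference:
  fixes x :: "'a::euclidean_space"
  assumes "\<delta> > 0" "\<epsilon> \<ge> 0" "2 * \<delta> + \<epsilon> < 1" "(x, r) \<in> Gset K \<epsilon> \<delta>"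
  defines "s \<equiv> step_factor TYPE('a) \<delta>"
  obtains b where "b \<in> Basis"
    "r \<le> 2 * infdist x K - infdist (x + (s * r) *\<^sub>R b) K - infdist (x - (s * r) *\<^sub>R b) K
        + (s * r)\<^sup>2 / infdist x K"
proof -
  define \<kappa> where "\<kappa> = 1 - 1 / (1 + 2 * \<delta>)\<^sup>2"
  have \<kappa>: "\<kappa> > 0"
    using assms by (simp add: \<kappa>_def field_simps)
  obtain z1 z2 where z: "0 < r" "r < infdist x K" "z1 \<in> K" "z2 \<in> K"
    "dist x z1 \<le> infdist x K + \<epsilon> * r" "dist x z2 \<le> infdist x K + \<epsilon> * r"
    "(z1 - x) \<bullet> (z2 - x) < cos_bound \<epsilon> \<delta> * (norm (z1 - x) * norm (z2 - x))"
    using assms by (auto simp: mem_Gset_iff)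
  have ne: "z1 \<noteq> x" "z2 \<noteq> x" using z by auto
  define w where "w = sgn (z1 - x) - sgn (z2 - x)"
  have "sgn (z1 - x) \<bullet> sgn (z2 - x) < cos_bound \<epsilon> \<delta>"
    using z(7) ne by (simp add: sgn_div_norm inverse_eq_divide pos_divide_less_eq mult_ac del: scaleR_diff_right)
  also have "\<dots> \<le> 1 - 2 * \<kappa>" using cos_bound_le[OF assms(1-3)] by (simp add: \<kappa>_def)
  finally have "4 * \<kappa> < 2 - 2 * (sgn (z1 - x) \<bullet> sgn (z2 - x))" by simp
  also have "\<dots> = (norm (sgn (z1 - x)))\<^sup>2 + (norm (sgn (z2 - x)))\<^sup>2 - 2 * (sgn (z1 - x) \<bullet> sgn (z2 - x))"
    using ne by (simp add: norm_sgn)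
  also have "\<dots> = (norm w)\<^sup>2"
    unfolding w_def power2_norm_eq_inner by (simp add: inner_simps inner_commute)
  finally have "sqrt (4 * \<kappa>) \<le> norm w" by (simp add: real_le_lsqrt)
  obtain b where b: "b \<in> Basis" "norm w \<le> sqrt (DIM('a)) * \<bar>w \<bullet> b\<bar>"
    using exists_Basis_norm_le by blast
  have s: "s = 3 / 2 * (sqrt DIM('a) / sqrt \<kappa>)"
    by (simp add: s_def step_factor_def \<kappa>_def real_sqrt_divide)
  have "3 = s * (sqrt (4 * \<kappa>) / sqrt DIM('a))"
    using \<kappa> by (simp add: s real_sqrt_mult)
  also have "\<dots> \<le> s * (norm w / sqrt DIM('a))"
    using \<kappa> \<open>sqrt (4 * \<kappa>) \<le> norm w\<close> by (intro mult_left_mono divide_right_mono) (auto simp: s)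
  also have "\<dots> \<le> s * \<bar>w \<bullet> b\<bar>"
    using b \<kappa> by (intro mult_left_mono) (auto simp: s divide_le_eq mult.commute)
  finally have "3 * r \<le> s * \<bar>w \<bullet> b\<bar> * r" using z by (intro mult_right_mono) auto
  moreover have "s \<ge> 0" using \<kappa> by (simp add: s)
  ultimately have "3 * r \<le> \<bar>((s * r) *\<^sub>R b) \<bullet> w\<bar>"
    using z by (simp add: abs_mult inner_commute mult_ac)
  moreover have "norm ((s * r) *\<^sub>R b) = s * r"
    using \<open>s \<ge> 0\<close> z b by simp
  moreover have "\<epsilon> * r \<le> r" using z assms by (simp add: mult_left_le_one_le)
  moreover have "0 < infdist x K" using z by simp
  ultimately show thesis
    using infdist_second_difference_le_two_points[OF _ z(3-6), of "(s * r) *\<^sub>R b"]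
    by (intro that[OF b(1)]) (simp flip: w_def)
qed

section \<open>Integrals of second differences over balls\<close>

text \<open>The ball of radius \<open>R - norm h\<close> about \<open>y\<close> lies in both balls,
  so the difference sits in a shell, whose measure Bernoulli's inequality bounds. If
  \<open>norm h \<ge> R\<close>, the right side already exceeds the measure of the whole
  ball.\<close>

lemma measure_ball_diff_le:
  fixes y h :: "'a::euclidean_space"
  assumes "R > 0"
  shows "measure lborel (ball y R - ball (y + h) R) \<le> DIM('a) * (norm h / R) * measure lborel (ball y R)"
proof (cases "norm h < R")
  case False
  have "1 \<le> DIM('a) * (norm h / R)"
  proof -
    have "1 * 1 \<le> real DIM('a) * (norm h / R)"
      using False assms DIM_positive[where 'a='a] by (intro mult_mono) (auto simp: field_simps Suc_le_eq)
    then show ?thesis by simp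
  qed
  then have "1 * measure lborel (ball y R) \<le> DIM('a) * (norm h / R) * measure lborel (ball y R)"
    by (rule mult_right_mono) auto
  moreover have "measure lborel (ball y R - ball (y + h) R) \<le> measure lborel (ball y R)"
    by (rule measure_mono_fmeasurable) (auto simp: fmeasurable_def intro!: emeasure_lborel_ball_finite[simplified])
  ultimately show ?thesis by simp
next
  case True
  define t where "t = norm h / R"
  have t: "0 \<le> t" "t \<le> 1" "R - norm h = (1 - t) * R" using True assms by (auto simp: t_def field_simps)
  have sub: "ball y (R - norm h) \<subseteq> ball y R" "ball y (R - norm h) \<subseteq> ball (y + h) R"
    using ball_subset_ball_iff[of y "R - norm h" "y+h" R] True by (auto simp: dist_norm intro!: subset_ball)
  have 1: "measure lborel (ball y (R - norm h)) = (1 - t) ^ DIM('a) * measure lborel (ball y R)"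
    using assms True t content_ball_conv_unit_ball[of "R - norm h" y] content_ball_conv_unit_ball[of R y]
    by (simp add: power_mult_distrib)
  have "1 - DIM('a) * t \<le> (1 - t) ^ DIM('a)"
    using Bernoulli_inequality[of "-t" "DIM('a)"] t by simp
  then have "(1 - DIM('a) * t) * measure lborel (ball y R) \<le> (1 - t) ^ DIM('a) * measure lborel (ball y R)"
    by (rule mult_right_mono) auto
  note this[folded 1]
  moreover have "measure lborel (ball y R - ball (y + h) R) \<le> measure lborel (ball y R - ball y (R - norm h))"
    by (rule measure_mono_fmeasurable)
       (use sub in \<open>auto intro!: fmeasurableI2[OF fmeasurableI[OF _ emeasure_lborel_ball_finite]]\<close>)
  moreover have "measure lborel (ball y R - ball y (R - norm h)) = measure lborel (ball y R) - measure lborel (ball y (R - norm h))"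
    by (rule measure_Diff) (use sub emeasure_lborel_ball_finite[of y R] in auto)
  ultimately show ?thesis by (simp add: t_def algebra_simps)
qed

lemma set_integrable_ball_continuous:
  fixes f :: "'a::euclidean_space \<Rightarrow> real"
  assumes "continuous_on UNIV f"
  shows "set_integrable lborel (ball y R) f"
proof -
  have "set_integrable lborel (cball y R) f"
    by (rule borel_integrable_compact[folded set_integrable_def])
       (use assms continuous_on_subset in auto)
  then show ?thesis by (rule set_integrable_subset) auto
qed

lemma set_lborel_integral_translate:
  fixes f :: "'a::euclidean_space \<Rightarrow> real"
  assumes [measurable]: "f \<in> borel_measurable borel"
  shows "(LINT x:ball y R|lborel. f (x - h)) = (LINT x:ball (y - h) R|lborel. f x)"
proof -
  have "(LINT x:ball (y - h) R|lborel. f x) = (LINT x|distr lborel borel ((+) (-h)). indicator (ball (y - h) R) x *\<^sub>R f x)"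
    by (simp add: set_lebesgue_integral_def lborel_distr_plus)
  also have "\<dots> = (LINT x|lborel. indicator (ball (y - h) R) (-h + x) *\<^sub>R f (-h + x))"
    by (rule integral_distr) (auto intro!: borel_measurable_times borel_measurable_indicator)
  also have "\<dots> = (LINT x:ball y R|lborel. f (x - h))"
    unfolding set_lebesgue_integral_def
    by (intro Bochner_Integration.integral_cong refl) (auto simp: indicator_def dist_norm algebra_simps)
  finally show ?thesis by simp
qed

text \<open>After translating the second half by \<open>h\<close> the first differences cancel,
  except on the symmetric difference of the two balls.\<close>

lemma integral_second_difference_le:
  fixes u :: "'a::euclidean_space \<Rightarrow> real"
  assumes lip: "\<And>x y. \<bar>u x - u y\<bar> \<le> dist x y" and "R > 0"
  shows "(LINT x:ball y R|lborel. 2 * u x - u (x + h) - u (x - h))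
     \<le> 2 * DIM('a) * (norm h)\<^sup>2 / R * measure lborel (ball y R)"
proof -
  define v where "v x = u x - u (x + h)" for x
  have cu: "continuous_on UNIV u"
    by (rule lipschitz_on_continuous_on[of 1]) (auto intro!: lipschitz_onI simp: dist_real_def lip)
  have cs: "continuous_on UNIV (\<lambda>x. u (x + g))" for g
    by (rule continuous_on_compose2[OF cu]) (auto intro!: continuous_intros)
  have cv: "continuous_on UNIV v" unfolding v_def by (intro continuous_intros cu cs)
  then have [measurable]: "v \<in> borel_measurable borel" by (rule borel_measurable_continuous_onI)
  have cv': "continuous_on UNIV (\<lambda>x. v (x - h))"
    by (rule continuous_on_compose2[OF cv]) (auto intro!: continuous_intros)
  have vle: "\<bar>v x\<bar> \<le> norm h" for x using lip[of x "x+h"] by (simp add: v_def dist_norm)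
  note int = set_integrable_ball_continuous
  let ?A = "ball y R" and ?B = "ball (y - h) R"
  have part: "set_integrable lborel (ball a R - S) v" "set_integrable lborel (ball a R \<inter> S) v"
    if [measurable]: "S \<in> sets borel" for a S
    by (rule set_integrable_subset[OF int[OF cv, of a R]]; auto)+
  have split: "(LINT x:ball a R|lborel. v x) = (LINT x:ball a R - ball b R|lborel. v x) + (LINT x:ball a R \<inter> ball b R|lborel. v x)" for a b
    using set_integral_Un[OF _ part, of a "ball b R" a "ball b R"]
    by (simp add: Diff_Int_distrib Un_Diff_Int Int_Diff disjoint_iff)
  \<comment> \<open>One factor \<open>norm h\<close> comes from the size of \<open>v\<close>, the
    other from the measure of the shell.\<close>
  have diff: "\<bar>LINT x:ball a R - ball (a + g) R|lborel. v x\<bar> \<le> DIM('a) * (norm h)\<^sup>2 / R * measure lborel (ball a R)"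
    if "norm g = norm h" for a g
  proof -
    let ?D = "ball a R - ball (a + g) R"
    have fD: "emeasure lborel ?D < \<infinity>"
      by (rule le_less_trans[OF emeasure_mono emeasure_lborel_ball_finite[of a R]]) auto
    have "\<bar>LINT x:?D|lborel. v x\<bar> \<le> (LINT x:?D|lborel. \<bar>v x\<bar>)"
      using set_integral_norm_bound[OF part(1)] by simp
    also have "\<dots> \<le> (LINT x:?D|lborel. norm h)"
      by (rule set_integral_mono) (use vle part(1) fD in \<open>auto intro!: set_integrable_abs simp: set_integrable_def[where f = "\<lambda>_. norm h"]\<close>)
    also have "\<dots> = measure lborel ?D * norm h"
      unfolding set_lebesgue_integral_def using fD by simp
    also have "\<dots> \<le> DIM('a) * (norm g / R) * measure lborel (ball a R) * norm h"
      by (intro mult_right_mono measure_ball_diff_le assms) auto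
    finally show ?thesis by (simp add: that power2_eq_square mult_ac)
  qed
  have "(LINT x:?A|lborel. 2 * u x - u (x + h) - u (x - h)) = (LINT x:?A|lborel. v x - v (x - h))"
    by (simp add: v_def algebra_simps)
  also have "\<dots> = (LINT x:?A|lborel. v x) - (LINT x:?A|lborel. v (x - h))"
    by (intro set_integral_diff int cv cv')
  also have "(LINT x:?A|lborel. v (x - h)) = (LINT x:?B|lborel. v x)"
    by (rule set_lborel_integral_translate) simp
  also have "(LINT x:?A|lborel. v x) - (LINT x:?B|lborel. v x)
      = (LINT x:?A - ?B|lborel. v x) - (LINT x:?B - ?A|lborel. v x)"
    using split[of y "y - h"] split[of "y - h" y] by (simp add: Int_commute)
  also have "\<dots> \<le> DIM('a) * (norm h)\<^sup>2 / R * measure lborel ?A + DIM('a) * (norm h)\<^sup>2 / R * measure lborel ?B"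
    using diff[of "-h" y] diff[of h "y - h"] by simp
  also have "measure lborel ?B = measure lborel ?A"
    using content_ball_conv_unit_ball[of R y] content_ball_conv_unit_ball[of R "y - h"] \<open>R > 0\<close> by simp
  finally show ?thesis by (simp add: mult_ac)
qed

section \<open>Measure of the slices away from \<open>K\<close>\<close>

text \<open>The first factor counts the basis directions. In the second, 2 k comes from the
  integrated second difference and 1 from the constant added to it.\<close>

definition slice_const :: "'a::euclidean_space itself \<Rightarrow> real \<Rightarrow> real" where
  "slice_const T \<delta> = DIM('a) * (2 * DIM('a) + 1) * (step_factor T \<delta>)\<^sup>2"

lemma slice_const_nonneg: "slice_const T \<delta> \<ge> 0"
  by (simp add: slice_const_def)

lemma Gset_slice_bound:
  fixes y :: "'a::euclidean_space"
  assumes \<delta>: "\<delta> > 0" "\<epsilon> \<ge> 0" "2 * \<delta> + \<epsilon> < 1" and "R > 0" "r > 0"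
    and far: "\<And>x. x \<in> ball y R \<Longrightarrow> R \<le> infdist x K"
  obtains M where "M \<in> sets borel" "slice (Gset K \<epsilon> \<delta>) r \<inter> ball y R \<subseteq> M"
    "emeasure lborel M \<le> ennreal (slice_const TYPE('a) \<delta> * r / R * measure lborel (ball y R))"
proof -
  define s where "s = step_factor TYPE('a) \<delta>"
  define f where "f x = infdist x K" for x
  \<comment> \<open>By semiconcavity the added constant makes \<open>P b\<close> nonnegative on the
    ball, so each \<open>P b\<close> is dominated by the sum \<open>Q\<close>.\<close>
  define P where "P b x = 2 * f x - f (x + (s * r) *\<^sub>R b) - f (x - (s * r) *\<^sub>R b) + (s * r)\<^sup>2 / R" for b x
  define Q where "Q x = (\<Sum>b\<in>Basis. P b x)" for x
  define M where "M = {x \<in> ball y R. r \<le> Q x}"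
  have cf: "continuous_on A f" for A unfolding f_def by (intro continuous_intros)
  have cs: "continuous_on UNIV (\<lambda>x. f (x + g))" "continuous_on UNIV (\<lambda>x. f (x - g))" for g
    by (rule continuous_on_compose2[OF cf]; auto intro!: continuous_intros)+
  have cD: "continuous_on UNIV (\<lambda>x. 2 * f x - f (x + g) - f (x - g))" for g
    by (intro continuous_intros cf cs)
  have cP: "continuous_on UNIV (P b)" for b unfolding P_def by (intro continuous_intros cf cs)
  have cQ: "continuous_on UNIV Q" unfolding Q_def by (intro continuous_intros cP)
  then have [measurable]: "Q \<in> borel_measurable borel" by (rule borel_measurable_continuous_onI)
  have [measurable]: "M \<in> sets borel" unfolding M_def by measurable
  have P0: "P b x \<ge> 0" if "b \<in> Basis" "x \<in> ball y R" for b x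
  proof -
    have "(norm ((s * r) *\<^sub>R b))\<^sup>2 / f x \<le> (s * r)\<^sup>2 / R"
      using that \<open>R > 0\<close> far[of x] by (intro frac_le) (auto simp: f_def)
    then show ?thesis
      using infdist_second_difference_le[of x K "(s * r) *\<^sub>R b"] far[OF that(2)] \<open>R > 0\<close>
      by (simp add: P_def f_def)
  qed
  have sub: "slice (Gset K \<epsilon> \<delta>) r \<inter> ball y R \<subseteq> M"
  proof
    fix x assume "x \<in> slice (Gset K \<epsilon> \<delta>) r \<inter> ball y R"
    then have x: "x \<in> ball y R" "(x, r) \<in> Gset K \<epsilon> \<delta>" by (auto simp: slice_def)
    obtain b where b: "b \<in> Basis" "r \<le> 2 * f x - f (x + (s * r) *\<^sub>R b) - f (x - (s * r) *\<^sub>R b)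
        + (s * r)\<^sup>2 / f x"
      unfolding f_def s_def using Gset_second_difference[OF \<delta> x(2)] by blast
    have "(s * r)\<^sup>2 / f x \<le> (s * r)\<^sup>2 / R"
      using x \<open>R > 0\<close> far[of x] by (intro frac_le) (auto simp: f_def)
    then have "r \<le> P b x" using b by (simp add: P_def)
    also have "\<dots> \<le> Q x" unfolding Q_def using P0 x b by (intro member_le_sum) auto
    finally show "x \<in> M" using x by (simp add: M_def)
  qed
  have intb: "(LINT x:ball y R|lborel. P b x) \<le> (2 * DIM('a) + 1) * (s * r)\<^sup>2 / R * measure lborel (ball y R)"
    if "b \<in> Basis" for b
  proof -
    have "(LINT x:ball y R|lborel. P b x) = (LINT x:ball y R|lborel. 2 * f x - f (x + (s * r) *\<^sub>R b) - f (x - (s * r) *\<^sub>R b))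
        + (LINT x:ball y R|lborel. (s * r)\<^sup>2 / R)"
      unfolding P_def by (intro set_integral_add set_integrable_ball_continuous cD continuous_intros)
    also have "(LINT x:ball y R|lborel. (s * r)\<^sup>2 / R) = (s * r)\<^sup>2 / R * measure lborel (ball y R)"
      unfolding set_lebesgue_integral_def using emeasure_lborel_ball_finite[of y R] by simp
    also have "(LINT x:ball y R|lborel. 2 * f x - f (x + (s * r) *\<^sub>R b) - f (x - (s * r) *\<^sub>R b))
      \<le> 2 * DIM('a) * (norm ((s * r) *\<^sub>R b))\<^sup>2 / R * measure lborel (ball y R)"
      by (rule integral_second_difference_le) (auto simp: f_def infdist_triangle_abs \<open>R > 0\<close>)
    also have "norm ((s * r) *\<^sub>R b) = \<bar>s * r\<bar>" using that by simp
    finally show ?thesis by (simp add: algebra_simps add_divide_distrib)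
  qed
  have iQ: "set_integrable lborel (ball y R) Q" by (rule set_integrable_ball_continuous[OF cQ])
  have fM: "emeasure lborel M < \<infinity>"
    by (rule le_less_trans[OF emeasure_mono emeasure_lborel_ball_finite[of y R]]) (auto simp: M_def)
  have "r * measure lborel M = (LINT x|lborel. r * indicator M x)"
    using fM by simp
  also have "\<dots> \<le> (LINT x:ball y R|lborel. Q x)"
    unfolding set_lebesgue_integral_def
  proof (rule integral_mono)
    show "integrable lborel (\<lambda>x. r * indicator M x)" using fM by simp
    show "integrable lborel (\<lambda>x. indicator (ball y R) x *\<^sub>R Q x)" using iQ by (simp add: set_integrable_def)
    show "r * indicator M x \<le> indicator (ball y R) x *\<^sub>R Q x" for x
      using P0 by (auto simp: M_def Q_def indicator_def intro!: sum_nonneg)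
  qed
  also have "\<dots> = (\<Sum>b\<in>Basis. LINT x:ball y R|lborel. P b x)"
    unfolding Q_def set_lebesgue_integral_def scaleR_sum_right
    by (rule Bochner_Integration.integral_sum)
       (rule set_integrable_ball_continuous[OF cP, unfolded set_integrable_def])
  also have "\<dots> \<le> (\<Sum>b\<in>(Basis::'a set). (2 * DIM('a) + 1) * (s * r)\<^sup>2 / R * measure lborel (ball y R))"
    by (intro sum_mono intb)
  also have "\<dots> = r * (slice_const TYPE('a) \<delta> * r / R * measure lborel (ball y R))"
    by (simp add: slice_const_def s_def power2_eq_square algebra_simps)
  finally have "measure lborel M \<le> slice_const TYPE('a) \<delta> * r / R * measure lborel (ball y R)"
    using \<open>r > 0\<close> by (rule mult_left_le_imp_le)
  then have "emeasure lborel M \<le> ennreal (slice_const TYPE('a) \<delta> * r / R * measure lborel (ball y R))"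
    using fM by (subst emeasure_eq_ennreal_measure) (auto simp: ennreal_leI)
  with \<open>M \<in> sets borel\<close> sub show thesis by (rule that)
qed

section \<open>Vitali covering and the Carleson inequality\<close>

text \<open>Countable subadditivity, with the sum as an integral over \<open>count_space\<close> so
  that it can be exchanged with the integral over the scales.\<close>

lemma emeasure_UN_countable_le:
  assumes "countable I" "\<And>i. i \<in> I \<Longrightarrow> A i \<in> sets M"
  shows "emeasure M (\<Union>i\<in>I. A i) \<le> (\<integral>\<^sup>+i. emeasure M (A i) \<partial>count_space I)"
proof -
  have "emeasure M (\<Union>i\<in>I. A i) = (\<integral>\<^sup>+x. indicator (\<Union>i\<in>I. A i) x \<partial>M)"
    using assms by (intro nn_integral_indicator[symmetric] sets.countable_UN'') auto
  also have "\<dots> \<le> (\<integral>\<^sup>+x. \<integral>\<^sup>+i. indicator (A i) x \<partial>count_space I \<partial>M)"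
  proof (intro nn_integral_mono)
    fix x
    show "indicator (\<Union>i\<in>I. A i) x \<le> (\<integral>\<^sup>+i. indicator (A i) x \<partial>count_space I :: ennreal)"
    proof (cases "\<exists>i\<in>I. x \<in> A i")
      case True
      then obtain i where "i \<in> I" "x \<in> A i" by blast
      then show ?thesis
        using nn_integral_ge_point[of i I "\<lambda>i. indicator (A i) x"] by (auto simp: indicator_def)
    qed simp
  qed
  also have "\<dots> = (\<integral>\<^sup>+i. \<integral>\<^sup>+x. indicator (A i) x \<partial>M \<partial>count_space I)"
    using assms by (intro nn_integral_count_space_nn_integral) auto
  also have "\<dots> = (\<integral>\<^sup>+i. emeasure M (A i) \<partial>count_space I)"
    using assms by (intro nn_integral_cong) auto
  finally show ?thesis .
qed

lemma emeasure_lborel_ball_scale: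
  fixes x y :: "'a::euclidean_space"
  assumes "R > 0" "t > 0"
  shows "emeasure lborel (ball x (t * R)) = ennreal (t ^ DIM('a)) * emeasure lborel (ball y R)"
  using content_ball_conv_unit_ball[of "t * R" x] content_ball_conv_unit_ball[of R y] assms
    emeasure_lborel_ball_finite[of x "t*R"] emeasure_lborel_ball_finite[of y R]
  by (simp add: emeasure_eq_ennreal_measure power_mult_distrib flip: ennreal_mult)

text \<open>The 3 is the length of the range of scales in units of the radius; 10 = 5 * 2 combines
  the Vitali enlargement with the passage from radius L to 2 L.\<close>

definition carleson_const :: "'a::euclidean_space itself \<Rightarrow> real \<Rightarrow> real" where
  "carleson_const T \<delta> = 3 * 10 ^ DIM('a) * slice_const T \<delta>"

lemma carleson_const_nonneg: "carleson_const T \<delta> \<ge> 0"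
  by (simp add: carleson_const_def slice_const_nonneg)

text \<open>On a Whitney-type ball \<open>ball x R\<close> only the scales \<open>r < 3 * R\<close> contribute.\<close>

lemma carleson_ineq_Gset:
  fixes K :: "'a::euclidean_space set"
  assumes \<delta>: "\<delta> > 0" "\<epsilon> \<ge> 0" "2 * \<delta> + \<epsilon> < 1"
  shows "carleson_ineq (Gset K \<epsilon> \<delta>) (carleson_const TYPE('a) \<delta>)"
  unfolding carleson_ineq_def
proof (intro allI impI)
  fix L :: real and c :: 'a
  assume L: "L > 0"
  define f where "f x = infdist x K" for x
  define G where "G = Gset K \<epsilon> \<delta>"
  define A where "A = slice_const TYPE('a) \<delta>"
  \<comment> \<open>The divisor is 2 * 5: after the Vitali enlargement by 5 the radius
    \<open>R x\<close> is half of \<open>min (f x) L\<close>, so that \<open>f \<ge> R x\<close>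
    still holds on \<open>ball x (R x)\<close>.\<close>
  define \<rho> where "\<rho> x = min (f x) L / 10" for x
  define R where "R x = 5 * \<rho> x" for x
  define S where "S = ball c L \<inter> {x. 0 < f x}"
  have A0: "A \<ge> 0" by (simp add: A_def slice_const_nonneg)
  have \<rho>: "\<rho> x > 0" if "x \<in> S" for x using that L by (auto simp: \<rho>_def S_def)
  have "S \<subseteq> (\<Union>x\<in>S. ball x (\<rho> x))" using \<rho> by auto
  moreover have "0 < \<rho> x \<and> \<rho> x \<le> L" if "x \<in> S" for x using \<rho>[OF that] L by (auto simp: \<rho>_def)
  ultimately obtain C where C: "countable C" "C \<subseteq> S"
     and disj: "pairwise (\<lambda>x y. disjnt (ball x (\<rho> x)) (ball y (\<rho> y))) C"
     and cover: "S \<subseteq> (\<Union>x\<in>C. ball x (R x))"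
    unfolding R_def by (rule Vitali_covering_lemma_balls)
  have R0: "R x > 0" if "x \<in> C" for x using \<rho>[of x] C that by (auto simp: R_def)
  have fp: "f p \<ge> R x" if "p \<in> ball x (R x)" for x p
    using that infdist_triangle[of x K p] by (auto simp: R_def \<rho>_def f_def)
  \<comment> \<open>The slice bound divided by \<open>r\<close>; it is constant in \<open>r\<close>
    below the cutoff, so the weight 1 / r causes no divergence at 0.\<close>
  define \<phi> where "\<phi> x r = ennreal (A / R x * measure lborel (ball x (R x))) * indicator {0<..<3 * R x} r" for x r

  have slice_le: "indicator {0<..<L} r * ennreal (1 / r) * emeasure lebesgue (slice G r \<inter> ball c L)
     \<le> (\<integral>\<^sup>+x. \<phi> x r \<partial>count_space C)" for r
  proof (cases "r \<in> {0<..<L}")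
    case r: True
    have "\<exists>M. M \<in> sets borel \<and> slice G r \<inter> ball x (R x) \<subseteq> M \<and>
      emeasure lborel M \<le> ennreal r * \<phi> x r" if xC: "x \<in> C" for x
    proof (cases "r < 3 * R x")
      case True
      obtain M where M: "M \<in> sets borel" "slice G r \<inter> ball x (R x) \<subseteq> M"
        "emeasure lborel M \<le> ennreal (A * r / R x * measure lborel (ball x (R x)))"
        unfolding G_def A_def
        by (rule Gset_slice_bound[OF \<delta>, of "R x" r x K]) (use r fp R0[OF xC] in \<open>auto simp: f_def\<close>)
      note M(3)
      also have "ennreal (A * r / R x * measure lborel (ball x (R x))) = ennreal r * \<phi> x r"
        using True r R0[OF xC] A0 by (simp add: \<phi>_def mult_ac flip: ennreal_mult)
      finally show ?thesis using M by blast
    next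
      case False
      \<comment> \<open>If \<open>f x \<le> L\<close>, then
        \<open>r < f p \<le> f x + R x = 3 * R x\<close>; otherwise
        \<open>r < L = 2 * R x\<close>.\<close>
      have "p \<notin> slice G r \<inter> ball x (R x)" for p
      proof
        assume p: "p \<in> slice G r \<inter> ball x (R x)"
        then have "r < f p" by (simp add: G_def slice_def Gset_def f_def)
        also have "f p \<le> f x + R x" using p infdist_triangle[of p K x] by (simp add: f_def dist_commute)
        finally show False using False r by (auto simp: R_def \<rho>_def min_def split: if_splits)
      qed
      then show ?thesis by (intro exI[of _ "{}"]) auto
    qed
    then obtain M where M: "\<And>x. x \<in> C \<Longrightarrow> M x \<in> sets borel"
      "\<And>x. x \<in> C \<Longrightarrow> slice G r \<inter> ball x (R x) \<subseteq> M x"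
      "\<And>x. x \<in> C \<Longrightarrow> emeasure lborel (M x) \<le> ennreal r * \<phi> x r" by metis
    have UM: "(\<Union>x\<in>C. M x) \<in> sets borel" using C M by (intro sets.countable_UN'') auto
    have "slice G r \<inter> ball c L \<subseteq> (\<Union>x\<in>C. M x)"
    proof
      fix p assume p: "p \<in> slice G r \<inter> ball c L"
      then have "p \<in> S" by (auto simp: S_def G_def slice_def Gset_def f_def)
      then show "p \<in> (\<Union>x\<in>C. M x)" using cover M(2) p by blast
    qed
    \<comment> \<open>Monotonicity needs only the larger set measurable: a non-measurable set has
      \<open>emeasure\<close> 0 by convention.\<close>
    then have "emeasure lebesgue (slice G r \<inter> ball c L) \<le> emeasure lebesgue (\<Union>x\<in>C. M x)"
      using UM by (intro emeasure_mono) auto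
    also have "\<dots> = emeasure lborel (\<Union>x\<in>C. M x)" using UM by simp
    also have "\<dots> \<le> (\<integral>\<^sup>+x. emeasure lborel (M x) \<partial>count_space C)"
      using C M by (intro emeasure_UN_countable_le) auto
    also have "\<dots> \<le> (\<integral>\<^sup>+x. ennreal r * \<phi> x r \<partial>count_space C)"
      using M by (intro nn_integral_mono) auto
    also have "\<dots> = ennreal r * (\<integral>\<^sup>+x. \<phi> x r \<partial>count_space C)"
      by (rule nn_integral_cmult) auto
    finally have "ennreal (1 / r) * emeasure lebesgue (slice G r \<inter> ball c L)
      \<le> ennreal (1 / r) * (ennreal r * (\<integral>\<^sup>+x. \<phi> x r \<partial>count_space C))" by (rule mult_left_mono) auto
    also have "\<dots> = (\<integral>\<^sup>+x. \<phi> x r \<partial>count_space C)"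
      using r by (simp flip: mult.assoc ennreal_mult)
    finally show ?thesis using r by simp
  qed simp

  have int_\<phi>: "(\<integral>\<^sup>+r. \<phi> x r \<partial>lborel) = ennreal (3 * A * 5 ^ DIM('a)) * emeasure lborel (ball x (\<rho> x))"
    if "x \<in> C" for x
  proof -
    have "(\<integral>\<^sup>+r. \<phi> x r \<partial>lborel) = ennreal (A / R x * measure lborel (ball x (R x))) * ennreal (3 * R x)"
      unfolding \<phi>_def using R0[OF that] by (subst nn_integral_cmult_indicator) auto
    also have "\<dots> = ennreal (3 * A) * ennreal (measure lborel (ball x (R x)))"
      using R0[OF that] A0 by (simp flip: ennreal_mult)
    also have "ennreal (measure lborel (ball x (R x))) = emeasure lborel (ball x (R x))"
      using emeasure_lborel_ball_finite[of x "R x"] by (intro emeasure_eq_ennreal_measure[symmetric]) simp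
    also have "\<dots> = ennreal (5 ^ DIM('a)) * emeasure lborel (ball x (\<rho> x))"
      unfolding R_def using R0[OF that] by (intro emeasure_lborel_ball_scale) (auto simp: R_def)
    finally show ?thesis using A0 by (simp add: ennreal_mult mult_ac)
  qed
  have sub: "ball x (\<rho> x) \<subseteq> ball c (2 * L)" if "x \<in> C" for x
  proof (rule subset_trans)
    show "ball x (\<rho> x) \<subseteq> ball x L" using L by (intro subset_ball) (auto simp: \<rho>_def)
    have "dist c x < L" using that C by (auto simp: S_def)
    then show "ball x L \<subseteq> ball c (2 * L)" by (simp add: ball_subset_ball_iff dist_commute)
  qed
  have "(\<integral>\<^sup>+ r. indicator {0<..<L} r * ennreal (1 / r) * emeasure lebesgue (slice G r \<inter> ball c L) \<partial>lborel)
     \<le> (\<integral>\<^sup>+r. \<integral>\<^sup>+x. \<phi> x r \<partial>count_space C \<partial>lborel)"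
    by (intro nn_integral_mono slice_le)
  also have "\<dots> = (\<integral>\<^sup>+x. \<integral>\<^sup>+r. \<phi> x r \<partial>lborel \<partial>count_space C)"
    by (rule nn_integral_count_space_nn_integral) (auto simp: C \<phi>_def)
  also have "\<dots> = (\<integral>\<^sup>+x. ennreal (3 * A * 5 ^ DIM('a)) * emeasure lborel (ball x (\<rho> x)) \<partial>count_space C)"
    by (intro nn_integral_cong) (auto simp: int_\<phi>)
  also have "\<dots> = ennreal (3 * A * 5 ^ DIM('a)) * (\<integral>\<^sup>+x. emeasure lborel (ball x (\<rho> x)) \<partial>count_space C)"
    by (rule nn_integral_cmult) auto
  also have "(\<integral>\<^sup>+x. emeasure lborel (ball x (\<rho> x)) \<partial>count_space C) = emeasure lborel (\<Union>x\<in>C. ball x (\<rho> x))"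
    using disj C by (intro emeasure_UN_countable[symmetric])
      (auto simp: disjoint_family_on_def pairwise_def disjnt_def)
  also have "\<dots> \<le> emeasure lborel (ball c (2 * L))"
    using sub by (intro emeasure_mono) auto
  also have "\<dots> = ennreal (2 ^ DIM('a)) * emeasure lborel (ball c L)"
    using L by (intro emeasure_lborel_ball_scale) auto
  also have "ennreal (3 * A * 5 ^ DIM('a)) * \<dots> = ennreal (carleson_const TYPE('a) \<delta>) * emeasure lborel (ball c L)"
  proof -
    have "3 * A * 5 ^ DIM('a) * 2 ^ DIM('a) = carleson_const TYPE('a) \<delta>"
      by (simp add: carleson_const_def A_def flip: power_mult_distrib)
    then show ?thesis using A0 by (simp flip: ennreal_mult mult.assoc)
  qed
  finally show "(\<integral>\<^sup>+ r. indicator {0<..<L} r * ennreal (1 / r) * emeasure lebesgue (slice (Gset K \<epsilon> \<delta>) r \<inter> ball c L) \<partial>lborel)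
      \<le> ennreal (carleson_const TYPE('a) \<delta>) * emeasure lebesgue (ball c L)"
    by (simp add: G_def mult_left_mono)
qed

section \<open>Lebesgue measurability of \<open>Gset\<close>\<close>

lemma null_sets_lborel_countable_sections:
  fixes N :: "('a::euclidean_space \<times> 'b::euclidean_space) set"
  assumes "N \<in> sets borel" "\<And>x. countable {y. (x, y) \<in> N}"
  shows "N \<in> null_sets lborel"
proof -
  have N: "N \<in> sets (lborel \<Otimes>\<^sub>M lborel)" by (metis assms(1) lborel_prod sets_lborel)
  have "emeasure (lborel \<Otimes>\<^sub>M lborel) N = (\<integral>\<^sup>+x. emeasure lborel (Pair x -` N) \<partial>lborel)"
    by (rule lborel.emeasure_pair_measure_alt[OF N])
  also have "\<dots> = (\<integral>\<^sup>+x. 0 \<partial>(lborel :: 'a measure))"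
    using assms(2) by (intro nn_integral_cong) (simp add: vimage_def emeasure_lborel_countable)
  finally show ?thesis using assms(1) by (simp add: null_sets_def lborel_prod)
qed

text \<open>For \<open>\<epsilon> > 0\<close> the set defined with strict inequalities is open, and for each \<open>x\<close>
  at most one scale \<open>r\<close> is lost: any larger scale satisfies the strict inequalities.\<close>

lemma Gset_measurable_pos:
  fixes K :: "'a::euclidean_space set"
  assumes \<delta>: "\<delta> > 0" "\<epsilon> > 0" "2 * \<delta> + \<epsilon> < 1"
  shows "Gset K \<epsilon> \<delta> \<in> sets lebesgue"
proof -
  define f where "f x = infdist x K" for x
  define ang where "ang x z1 z2 \<longleftrightarrow> (z1 - x) \<bullet> (z2 - x) < cos_bound \<epsilon> \<delta> * (norm (z1 - x) * norm (z2 - x))" for x z1 z2 :: 'a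
  define H where "H = (\<Union>z1\<in>K. \<Union>z2\<in>K. {p. 0 < snd p \<and> snd p < f (fst p) \<and>
     dist (fst p) z1 < f (fst p) + \<epsilon> * snd p \<and> dist (fst p) z2 < f (fst p) + \<epsilon> * snd p \<and> ang (fst p) z1 z2})"
  have G: "(x, r) \<in> Gset K \<epsilon> \<delta> \<longleftrightarrow> 0 < r \<and> r < f x \<and>
      (\<exists>z1\<in>K. \<exists>z2\<in>K. dist x z1 \<le> f x + \<epsilon> * r \<and> dist x z2 \<le> f x + \<epsilon> * r \<and> ang x z1 z2)" for x r
    using \<delta> by (auto simp: mem_Gset_iff ang_def f_def)
  have "open H"
    unfolding H_def f_def ang_def
    by (intro open_UN ballI open_Collect_conj open_Collect_less continuous_intros)
  define T where "T n p = (fst p, snd p + 1 / Suc n)" for n and p :: "'a \<times> real"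
  \<comment> \<open>A Borel set that contains the part of \<open>Gset\<close> outside
    \<open>H\<close>: the points below the graph of \<open>f\<close> and outside \<open>H\<close>
    whose small upward shifts eventually lie in \<open>H\<close>.\<close>
  define N where "N = - H \<inter> {p. snd p < f (fst p)} \<inter> (\<Union>m. \<Inter>n\<in>{m..}. T n -` H)"
  have [measurable]: "H \<in> sets borel" using \<open>open H\<close> by simp
  have "open (T n -` H)" for n
    using \<open>open H\<close> unfolding T_def by (rule open_vimage) (intro continuous_intros)
  then have [measurable]: "T n -` H \<in> sets borel" for n by simp
  have "open {p :: 'a \<times> real. snd p < f (fst p)}"
    unfolding f_def by (intro open_Collect_less continuous_intros)
  then have [measurable]: "{p :: 'a \<times> real. snd p < f (fst p)} \<in> sets borel" by simp
  have "N \<in> sets borel" unfolding N_def by measurable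
  moreover have "countable {r. (x, r) \<in> N}" for x
  proof -
    have "False" if rr': "(x, r) \<in> N" "(x, r') \<in> N" "r < r'" for r r'
    proof -
      \<comment> \<open>A sufficiently small shift of \<open>(x, r)\<close> lies in \<open>H\<close>
        at a scale at most \<open>r'\<close>. Below \<open>f x\<close> the conditions of
        \<open>H\<close> persist when the scale grows, so \<open>(x, r')\<close> would lie in
        \<open>H\<close> too.\<close>
      obtain m where m: "\<forall>n\<ge>m. T n (x, r) \<in> H" using rr'(1) by (auto simp: N_def)
      obtain n where n: "1 / real (Suc n) < r' - r"
        using rr'(3) by (metis diff_gt_0_iff_gt nat_approx_posE)
      have "1 / real (Suc (max m n)) \<le> 1 / real (Suc n)" by (intro divide_left_mono) auto
      then have le: "r + 1 / real (Suc (max m n)) \<le> r'" using n by simp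
      then have "\<epsilon> * (r + 1 / real (Suc (max m n))) \<le> \<epsilon> * r'" using \<delta> by (intro mult_left_mono) auto
      moreover have "r' < f x" "(x, r') \<notin> H" using that by (auto simp: N_def)
      ultimately show False using m[rule_format, of "max m n"] le by (force simp: H_def T_def)
    qed
    then have "r = r'" if "(x, r) \<in> N" "(x, r') \<in> N" for r r' using that by (meson linorder_neqE)
    then have "{r. (x, r) \<in> N} \<subseteq> {SOME r. (x, r) \<in> N}" by (auto intro: someI2)
    then show ?thesis by (rule countable_subset) simp
  qed
  ultimately have "N \<in> null_sets lborel" by (rule null_sets_lborel_countable_sections)
  moreover have "Gset K \<epsilon> \<delta> - H \<subseteq> N"
  proof clarify
    fix x r assume xr: "(x, r) \<in> Gset K \<epsilon> \<delta>" "(x, r) \<notin> H"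
    then obtain z1 z2 where z: "0 < r" "r < f x" "z1 \<in> K" "z2 \<in> K"
      "dist x z1 \<le> f x + \<epsilon> * r" "dist x z2 \<le> f x + \<epsilon> * r" "ang x z1 z2"
      by (auto simp: G)
    obtain m where m: "1 / real (Suc m) < f x - r"
      using z(2) by (metis diff_gt_0_iff_gt nat_approx_posE)
    \<comment> \<open>A shift makes the weak inequalities strict because \<epsilon> > 0, and the
      choice of \<open>m\<close> keeps the scale below \<open>f x\<close>.\<close>
    have "T n (x, r) \<in> H" if "n \<ge> m" for n
    proof -
      have "1 / real (Suc n) \<le> 1 / real (Suc m)" using that by (intro divide_left_mono) auto
      then have "r + 1 / real (Suc n) < f x" using m by simp
      moreover have "\<epsilon> * r < \<epsilon> * (r + 1 / real (Suc n))" using \<delta> by simp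
      moreover have "0 < r + 1 / real (Suc n)" using z by (simp add: add_pos_pos)
      ultimately show ?thesis using z unfolding H_def T_def by force
    qed
    then show "(x, r) \<in> N" using xr z(2) by (auto simp: N_def)
  qed
  ultimately have "Gset K \<epsilon> \<delta> - H \<in> null_sets lebesgue"
    by (meson null_sets_completion_subset null_sets_completionI)
  moreover have "H \<subseteq> Gset K \<epsilon> \<delta>"
  proof clarify
    fix x r assume "(x, r) \<in> H"
    then obtain z1 z2 where "0 < r" "r < f x" "z1 \<in> K" "z2 \<in> K"
      "dist x z1 < f x + \<epsilon> * r" "dist x z2 < f x + \<epsilon> * r" "ang x z1 z2"
      by (auto simp: H_def)
    then show "(x, r) \<in> Gset K \<epsilon> \<delta>" unfolding G by (meson less_imp_le)
  qed
  ultimately show ?thesis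
    by (metis Diff_partition \<open>H \<in> sets borel\<close> null_setsD2 sets.Un sets_completionI_sets sets_lborel)
qed

text \<open>For \<open>\<epsilon> = 0\<close> the slices increase as \<open>r\<close> decreases, whereas their measure is locally \<open>O(r)\<close>.\<close>

lemma Gset_measurable_zero:
  fixes K :: "'a::euclidean_space set"
  assumes "\<delta> > 0" "2 * \<delta> < 1"
  shows "Gset K 0 \<delta> \<in> sets lebesgue"
proof -
  define A where "A = slice_const TYPE('a) \<delta>"
  have A0: "A \<ge> 0" by (simp add: A_def slice_const_nonneg)
  have mono: "(x, r') \<in> Gset K 0 \<delta>" if "(x, r) \<in> Gset K 0 \<delta>" "0 < r'" "r' \<le> r" for x r r'
    using that by (auto simp: Gset_def)
  have neg: "negligible (slice (Gset K 0 \<delta>) r)" for r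
  \<comment> \<open>Negligibility is checked locally because the slice bound needs a ball on which
    the distance to \<open>K\<close> is at least the radius.\<close>
  proof (subst locally_negligible_alt, intro ballI)
    fix x assume x: "x \<in> slice (Gset K 0 \<delta>) r"
    define R where "R = infdist x K / 2"
    define U where "U = slice (Gset K 0 \<delta>) r \<inter> ball x R"
    have r: "0 < r" "0 < R" using x by (auto simp: slice_def Gset_def R_def)
    have far: "R \<le> infdist y K" if "y \<in> ball x R" for y
      using that infdist_triangle[of x K y] by (simp add: R_def)
    have "negligible U"
      unfolding negligible_outer_le
    proof (intro allI impI)
      fix e :: real assume e: "e > 0"
      define B where "B = A / R * measure lborel (ball x R) + 1"
      have B: "B > 0" using A0 r by (simp add: B_def add_nonneg_pos)
      \<comment> \<open>At scale \<open>t\<close> the slice bound is at most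
        \<open>t * B \<le> e\<close>, and the slice at \<open>r\<close> is contained in the slice at
        \<open>t\<close>. The 1 in \<open>B\<close> only keeps it positive.\<close>
      define t where "t = min r (e / B)"
      have t: "t > 0" "t \<le> r" using e B r by (auto simp: t_def)
      obtain M where M: "M \<in> sets borel" "slice (Gset K 0 \<delta>) t \<inter> ball x R \<subseteq> M"
        "emeasure lborel M \<le> ennreal (A * t / R * measure lborel (ball x R))"
        unfolding A_def by (rule Gset_slice_bound[of \<delta> 0 R t x K]) (use assms r t far in auto)
      have fin: "emeasure lborel M < \<infinity>" using M(3) by (rule le_less_trans) simp
      have "measure lborel M \<le> A * t / R * measure lborel (ball x R)"
        unfolding measure_def using M(3) A0 r t by (intro enn2real_leI) (auto simp: measure_def)
      also have "\<dots> \<le> t * B" using t by (simp add: B_def algebra_simps)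
      also have "\<dots> \<le> e / B * B" using B by (intro mult_right_mono) (auto simp: t_def)
      finally have "measure lebesgue M \<le> e" using M(1) B by simp
      moreover have "M \<in> lmeasurable" using M(1) fin by (auto simp: fmeasurable_def)
      moreover have "U \<subseteq> M" using M(2) mono t by (auto simp: U_def slice_def)
      ultimately show "\<exists>T. U \<subseteq> T \<and> T \<in> lmeasurable \<and> measure lebesgue T \<le> e" by blast
    qed
    moreover have "openin (top_of_set (slice (Gset K 0 \<delta>) r)) U"
      unfolding U_def by (rule openin_open_Int) simp
    moreover have "x \<in> U" using x r by (simp add: U_def)
    ultimately show "\<exists>U. openin (top_of_set (slice (Gset K 0 \<delta>) r)) U \<and> x \<in> U \<and> negligible U" by blast
  qed
  \<comment> \<open>Every positive scale exceeds some 1 / (n + 1), so by \<open>mono\<close> the set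
    \<open>Z\<close> contains the projection of \<open>Gset K 0 \<delta>\<close> to the
    space.\<close>
  define Z where "Z = (\<Union>n. slice (Gset K 0 \<delta>) (1 / Suc n))"
  have "negligible Z" unfolding Z_def using neg by (intro negligible_Union_nat)
  then obtain Z' where Z': "Z' \<in> null_sets lborel" "Z \<subseteq> Z'"
    by (auto simp: negligible_iff_null_sets null_sets_completion_iff2)
  have "Z' \<times> (UNIV::real set) \<in> null_sets (lborel \<Otimes>\<^sub>M lborel)"
    by (rule lborel.times_in_null_sets1[OF Z'(1)]) simp
  then have "Z' \<times> (UNIV::real set) \<in> null_sets lborel" by (simp add: lborel_prod)
  moreover have "Gset K 0 \<delta> \<subseteq> Z' \<times> UNIV"
  proof (rule subrelI)
    fix x r assume xr: "(x, r) \<in> Gset K 0 \<delta>"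
    then have "0 < r" by (simp add: Gset_def)
    then obtain n where "1 / real (Suc n) < r" using nat_approx_posE by blast
    then have "(x, 1 / real (Suc n)) \<in> Gset K 0 \<delta>" using mono[OF xr] by simp
    then have "x \<in> Z" by (auto simp: Z_def slice_def)
    then show "(x, r) \<in> Z' \<times> UNIV" using Z' by auto
  qed
  ultimately have "Gset K 0 \<delta> \<in> null_sets lebesgue"
    by (meson null_sets_completion_subset null_sets_completionI)
  then show ?thesis by (rule null_setsD2)
qed

theorem theorem1p3:
  fixes \<delta> :: real
  assumes "\<delta> > 0"
  shows "\<exists>C::real \<ge> 0. \<forall>(K::'a::euclidean_space set) \<epsilon>::real.
           \<epsilon> \<ge> 0 \<and> 2 * \<delta> + \<epsilon> < 1 \<longrightarrow> carleson_set (Gset K \<epsilon> \<delta>) \<and> carleson_ineq (Gset K \<epsilon> \<delta>) C"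
proof -
  have "carleson_set (Gset K \<epsilon> \<delta>) \<and> carleson_ineq (Gset K \<epsilon> \<delta>) (carleson_const TYPE('a) \<delta>)"
    if "\<epsilon> \<ge> 0" "2 * \<delta> + \<epsilon> < 1" for K :: "'a set" and \<epsilon>
  proof -
    have "Gset K \<epsilon> \<delta> \<in> sets lebesgue"
      using Gset_measurable_pos[of \<delta> \<epsilon> K] Gset_measurable_zero[of \<delta> K] assms that
      by (cases "\<epsilon> = 0") auto
    moreover have "Gset K \<epsilon> \<delta> \<subseteq> UNIV \<times> {0<..}" by (auto simp: Gset_def)
    ultimately show ?thesis
      using carleson_ineq_Gset[OF assms that, of K] carleson_const_nonneg
      unfolding carleson_set_def by blast
  qed
  then show ?thesis using carleson_const_nonneg by blast
qed

end
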